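(* Let $X$ be a complete separable perfect metric space, let $g : X \to X$ be an almost regular mapping, let $S \subset X$ be a closed nowhere dense set with $X \setminus \Gamma_g \subset S$, and let $f : X_\bullet \to X_\bullet$ be the mapping associated with $g$ and $S$. Suppose that $S$ is finite and that $\Sigma_f \neq \varnothing$. Then $\Sigma_f$ contains (as subsets) at least one and at most $\#(S)$ minimal elements of $\mathcal{D}^\diamond_f$, where $\#(S)$ is the cardinality of $S$.
   Context: Perfect means having no isolated points. For a mapping $g : X \to X$ and an open set $O \subset X$, $g$ is regular on $O$ if the restriction $g|_O : O \to X$ is continuous and open; $\Gamma_g$ is the largest open set on which $g$ is regular, and $g$ is almost regular if $\Gamma_g$ is dense in $X$. Let $\bullet$ be an element not in $X$, $X_\bullet = X \cup \{\bullet\}$, and define $f : X_\bullet \to X_\bullet$ by $f(x) = g(x)$ if $x \in X \setminus S$ and $f(x) = \bullet$ if $x \in S \cup \{\bullet\}$; $f^n$ denotes the $n$-th iterate ($f^0 = \mathrm{id}$). $X_\bullet$ carries no topology; all topological notions refer to $X$. A set $A \subset X$ is $f_{\setminus S}$-invariant if $f(A \setminus S) \subset A$; it is fully $f_{\setminus S}$-invariant if both $A$ and $X \setminus A$ are $f_{\setminus S}$-invariant. For $A \subset X$, $\Delta_f(A)$ is the least fully $f_{\setminus S}$-invariant subset of $X$ containing $A$ (the intersection of all of them). For $B \subset X$ put $B^\diamond = \mathrm{int}(\overline{B})$; an open set $O$ is regular open if $O = O^\diamond$. Put $\Delta^\diamond_f(A) = (\Delta_f(A))^\diamond$ and $\Sigma_f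 = \Delta^\diamond_f(S)$. $\mathcal{D}^\diamond_f$ is the set of all non-empty regular open fully $f_{\setminus S}$-invariant subsets of $X$. An element $D \in \mathcal{D}^\diamond_f$ is minimal if the only element of $\mathcal{D}^\diamond_f$ which is a subset of $D$ is $D$ itself. *)

theory Defs
  imports "HOL-Analysis.Analysis"
begin

definition regular_on :: "'a::topological_space set \<Rightarrow> ('a \<Rightarrow> 'a) \<Rightarrow> bool" where
  "regular_on U g \<longleftrightarrow> continuous_on U g \<and> open_map (top_of_set U) euclidean g"

definition regular_domain :: "('a::topological_space \<Rightarrow> 'a) \<Rightarrow> 'a set" where
  "regular_domain g = \<Union>{U. open U \<and> regular_on U g}"

(* The union is itself a member of the family, so it is the largest open set
   on which g is regular. *)
lemma regular_domain_greatest: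
  "open (regular_domain g)"
  "regular_on (regular_domain g) g"
  "\<lbrakk>open U; regular_on U g\<rbrakk> \<Longrightarrow> U \<subseteq> regular_domain g"
proof -
  let ?F = "{U. open U \<and> regular_on U g}"
  show op: "open (regular_domain g)"
    unfolding regular_domain_def by auto
  show "U \<subseteq> regular_domain g" if "open U" "regular_on U g" for U
    unfolding regular_domain_def using that by auto
  have "continuous_on (\<Union>?F) g"
    by (rule continuous_on_open_Union) (auto simp: regular_on_def)
  moreover have "open (g ` V)" if V: "open V" "V \<subseteq> \<Union>?F" for V
  proof -
    have "open (g ` (V \<inter> U))" if "U \<in> ?F" for U
    proof -
      have "openin (top_of_set U) (V \<inter> U)"
        using that V(1) by (simp add: openin_open_eq open_Int)
      moreover have "open_map (top_of_set U) euclidean g"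
        using that by (simp add: regular_on_def)
      ultimately have "openin euclidean (g ` (V \<inter> U))"
        unfolding open_map_def by blast
      then show ?thesis by simp
    qed
    then have "open (\<Union>U\<in>?F. g ` (V \<inter> U))"
      by blast
    moreover have "g ` V = (\<Union>U\<in>?F. g ` (V \<inter> U))"
      using V(2) by blast
    ultimately show ?thesis by simp
  qed
  ultimately show "regular_on (regular_domain g) g"
    using op by (auto simp: regular_on_def open_map_def openin_open_eq regular_domain_def)
qed

definition almost_regular :: "('a::topological_space \<Rightarrow> 'a) \<Rightarrow> bool" where
  "almost_regular g \<longleftrightarrow> closure (regular_domain g) = UNIV"

(* The extension of X by one extra point is 'a option; None is the added point. *)
definition assoc_map :: "('a \<Rightarrow> 'a) \<Rightarrow> 'a set \<Rightarrow> 'a option \<Rightarrow> 'a option" where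
  "assoc_map g S z =
     (case z of None \<Rightarrow> None | Some x \<Rightarrow> if x \<in> S then None else Some (g x))"

definition invariant :: "('a option \<Rightarrow> 'a option) \<Rightarrow> 'a set \<Rightarrow> 'a set \<Rightarrow> bool" where
  "invariant f S A \<longleftrightarrow> f ` Some ` (A - S) \<subseteq> Some ` A"

definition fully_invariant :: "('a option \<Rightarrow> 'a option) \<Rightarrow> 'a set \<Rightarrow> 'a set \<Rightarrow> bool" where
  "fully_invariant f S A \<longleftrightarrow> invariant f S A \<and> invariant f S (- A)"

definition Delta :: "('a option \<Rightarrow> 'a option) \<Rightarrow> 'a set \<Rightarrow> 'a set \<Rightarrow> 'a set" where
  "Delta f S A = \<Inter>{B. A \<subseteq> B \<and> fully_invariant f S B}"

definition diamond :: "'a::topological_space set \<Rightarrow> 'a set" where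
  "diamond B = interior (closure B)"

definition regular_open :: "'a::topological_space set \<Rightarrow> bool" where
  "regular_open U \<longleftrightarrow> open U \<and> U = diamond U"

definition Delta_diamond ::
    "('a::topological_space option \<Rightarrow> 'a option) \<Rightarrow> 'a set \<Rightarrow> 'a set \<Rightarrow> 'a set" where
  "Delta_diamond f S A = diamond (Delta f S A)"

definition Sigma_set ::
    "('a::topological_space option \<Rightarrow> 'a option) \<Rightarrow> 'a set \<Rightarrow> 'a set" where
  "Sigma_set f S = Delta_diamond f S S"

definition D_diamond ::
    "('a::topological_space option \<Rightarrow> 'a option) \<Rightarrow> 'a set \<Rightarrow> 'a set set" where
  "D_diamond f S = {D. D \<noteq> {} \<and> regular_open D \<and> fully_invariant f S D}"

definition minimal_in :: "'a set \<Rightarrow> 'a set set \<Rightarrow> bool" where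
  "minimal_in D \<D> \<longleftrightarrow> D \<in> \<D> \<and> (\<forall>E\<in>\<D>. E \<subseteq> D \<longrightarrow> E = D)"

end

theory Submission
  imports Defs
begin

text \<open>
  Off \<open>S\<close> the map \<open>g\<close> is continuous and open, and this is exactly what makes interiors of fully
  invariant sets fully invariant: openness carries the interior forwards along \<open>g\<close>, continuity
  carries it backwards.  Full invariance is symmetric under complements, so closures inherit it
  as well.  Hence \<open>D_diamond f S\<close>, together with the empty set, is closed under \<open>D \<inter> E\<close> and
  under the regular open difference \<open>D - closure E\<close>, and a non-empty \<open>Sigma_set f S\<close>
  belongs to it (\<open>D_diamond_Int\<close>, \<open>D_diamond_Diff_closure\<close>, \<open>Sigma_set_in_D_diamond\<close>).

  The second ingredient is that \<open>S\<close> detects every member \<open>D\<close> of \<open>D_diamond f S\<close> inside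
  \<open>Sigma_set f S\<close>: such a \<open>D\<close> is open, so it meets the set \<open>Delta f S S\<close> which is dense in
  \<open>Sigma_set f S\<close>; and \<open>Delta f S S\<close> is the least fully invariant set containing \<open>S\<close>, so a
  fully invariant set that meets it must meet \<open>S\<close> itself
  (\<open>D_diamond_below_Sigma_meets\<close>).

  Both bounds follow by counting points of \<open>S\<close>.  Distinct minimal elements are disjoint, and each
  one inside \<open>Sigma_set f S\<close> contains a point of \<open>S\<close>, so there are at most \<open>card S\<close> of them.
  Conversely, a member \<open>D\<close> below \<open>Sigma_set f S\<close> with the fewest points of \<open>S\<close> is minimal: if
  \<open>E \<subseteq> D\<close> were a smaller member, then \<open>D - closure E\<close> would be a member too and so contain a
  point of \<open>S\<close>, which is then missing from \<open>E\<close>; thus \<open>E\<close> would have fewer points of \<open>S\<close> than \<open>D\<close>.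
\<close>

section \<open>Regular open sets\<close>

lemma regular_open_diamond: "regular_open (diamond B)"
proof -
  have "closure (interior (closure B)) \<subseteq> closure B"
    by (simp add: closure_minimal interior_subset)
  then have "diamond (diamond B) \<subseteq> diamond B"
    unfolding diamond_def by (rule interior_mono)
  moreover have "diamond B \<subseteq> diamond (diamond B)"
    unfolding diamond_def by (simp add: closure_subset interior_maximal)
  ultimately show ?thesis
    by (auto simp: regular_open_def diamond_def)
qed

lemma regular_open_Int:
  assumes "regular_open D" "regular_open E"
  shows "regular_open (D \<inter> E)"
proof -
  have "diamond (D \<inter> E) \<subseteq> diamond D \<inter> diamond E"
    unfolding diamond_def by (simp add: closure_mono interior_mono)
  moreover have "D \<inter> E \<subseteq> diamond (D \<inter> E)" if "open (D \<inter> E)"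
    unfolding diamond_def using that by (simp add: closure_subset interior_maximal)
  ultimately show ?thesis
    using assms unfolding regular_open_def by blast
qed

lemma regular_open_Compl_closure:
  assumes "open E"
  shows "regular_open (- closure E)"
proof -
  have "- closure E = diamond (- E)"
    using assms by (simp add: diamond_def closure_closed closed_Compl interior_complement)
  then show ?thesis
    by (simp add: regular_open_diamond)
qed

section \<open>Fully invariant sets\<close>

text \<open>
  Full invariance says that membership is constant along the arrows \<open>x \<mapsto> g x\<close> with \<open>x\<close> outside
  \<open>S\<close>.  In this form the closure of the fully invariant sets under all Boolean operations is plain.
\<close>

lemma fully_invariant_assoc_map_iff:
  "fully_invariant (assoc_map g S) S A \<longleftrightarrow> (\<forall>x. x \<notin> S \<longrightarrow> (g x \<in> A \<longleftrightarrow> x \<in> A))"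
proof -
  have "invariant (assoc_map g S) S B \<longleftrightarrow> (\<forall>x \<in> B - S. g x \<in> B)" for B
    unfolding invariant_def by (auto simp: assoc_map_def image_subset_iff)
  then show ?thesis
    unfolding fully_invariant_def by auto
qed

lemma fully_invariant_Compl:
  "fully_invariant f S (- A) \<longleftrightarrow> fully_invariant f S A"
  unfolding fully_invariant_def by auto

lemma fully_invariant_Int:
  assumes "fully_invariant (assoc_map g S) S A" "fully_invariant (assoc_map g S) S B"
  shows "fully_invariant (assoc_map g S) S (A \<inter> B)"
  using assms unfolding fully_invariant_assoc_map_iff by auto

lemma fully_invariant_Delta: "fully_invariant (assoc_map g S) S (Delta (assoc_map g S) S A)"
  unfolding Delta_def fully_invariant_assoc_map_iff by blast

text \<open>
  A fully invariant set disjoint from \<open>A\<close> has a fully invariant complement, and that complement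
  competes in the intersection defining \<open>Delta f S A\<close>.
\<close>

lemma fully_invariant_meets_Delta:
  assumes "fully_invariant f S D" "D \<inter> Delta f S A \<noteq> {}"
  shows "D \<inter> A \<noteq> {}"
proof
  assume "D \<inter> A = {}"
  then have "Delta f S A \<subseteq> - D"
    using assms(1) unfolding Delta_def by (intro Inter_lower) (auto simp: fully_invariant_Compl)
  then show False
    using assms(2) by blast
qed

lemma fully_invariant_interior:
  fixes g :: "'a::topological_space \<Rightarrow> 'a"
  assumes "closed S" and reg: "regular_on (- S) g"
    and A: "fully_invariant (assoc_map g S) S A"
  shows "fully_invariant (assoc_map g S) S (interior A)"
  unfolding fully_invariant_assoc_map_iff
proof (intro allI impI iffI)
  have off: "open (- S)"
    using \<open>closed S\<close> by (simp add: open_Compl)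
  fix x assume x: "x \<notin> S"
  show "x \<in> interior A" if "g x \<in> interior A"
  proof (rule interiorI)
    have "continuous_on (- S) g"
      using reg by (simp add: regular_on_def)
    then show "open (- S \<inter> g -` interior A)"
      using off by (simp add: continuous_open_preimage)
    show "x \<in> - S \<inter> g -` interior A"
      using x that by simp
    show "- S \<inter> g -` interior A \<subseteq> A"
      using A interior_subset unfolding fully_invariant_assoc_map_iff by blast
  qed
  show "g x \<in> interior A" if "x \<in> interior A"
  proof (rule interiorI)
    have "openin (top_of_set (- S)) (- S \<inter> interior A)"
      by (simp add: openin_open_Int)
    then show "open (g ` (- S \<inter> interior A))"
      using reg unfolding regular_on_def open_map_def by (metis open_openin)
    show "g x \<in> g ` (- S \<inter> interior A)"
      using x that by simp
    show "g ` (- S \<inter> interior A) \<subseteq> A"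
      using A interior_subset unfolding fully_invariant_assoc_map_iff by blast
  qed
qed

lemma fully_invariant_closure:
  fixes g :: "'a::topological_space \<Rightarrow> 'a"
  assumes "closed S" "regular_on (- S) g" "fully_invariant (assoc_map g S) S A"
  shows "fully_invariant (assoc_map g S) S (closure A)"
proof -
  have "fully_invariant (assoc_map g S) S (interior (- A))"
    using assms by (simp add: fully_invariant_interior fully_invariant_Compl)
  then show ?thesis
    by (simp add: interior_complement fully_invariant_Compl)
qed

section \<open>Regular open fully invariant sets\<close>

lemma D_diamond_Int:
  assumes "D \<in> D_diamond (assoc_map g S) S" "E \<in> D_diamond (assoc_map g S) S" "D \<inter> E \<noteq> {}"
  shows "D \<inter> E \<in> D_diamond (assoc_map g S) S"
  using assms by (simp add: D_diamond_def regular_open_Int fully_invariant_Int)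

lemma D_diamond_Diff_closure:
  fixes g :: "'a::topological_space \<Rightarrow> 'a"
  assumes "closed S" "regular_on (- S) g"
    and D: "D \<in> D_diamond (assoc_map g S) S" and E: "E \<in> D_diamond (assoc_map g S) S"
    and "\<not> D \<subseteq> E"
  shows "D - closure E \<in> D_diamond (assoc_map g S) S"
proof -
  have "D \<inter> - closure E \<noteq> {}"
  proof
    assume "D \<inter> - closure E = {}"
    \<comment> \<open>An open set inside the closure of a regular open set already lies in that set.\<close>
    then have "D \<subseteq> closure E"
      by blast
    then have "D \<subseteq> diamond E"
      using D by (simp add: D_diamond_def regular_open_def diamond_def interior_maximal)
    then show False
      using E \<open>\<not> D \<subseteq> E\<close> by (simp add: D_diamond_def regular_open_def)
  qed
  moreover have "open E"
    using E by (simp add: D_diamond_def regular_open_def)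
  then have "regular_open (- closure E)"
    by (rule regular_open_Compl_closure)
  moreover have "fully_invariant (assoc_map g S) S (- closure E)"
    using assms by (simp add: D_diamond_def fully_invariant_Compl fully_invariant_closure)
  ultimately show ?thesis
    using D by (simp add: D_diamond_def Diff_eq regular_open_Int fully_invariant_Int)
qed

lemma Sigma_set_in_D_diamond:
  fixes g :: "'a::topological_space \<Rightarrow> 'a"
  assumes "closed S" "regular_on (- S) g" "Sigma_set (assoc_map g S) S \<noteq> {}"
  shows "Sigma_set (assoc_map g S) S \<in> D_diamond (assoc_map g S) S"
proof -
  have "fully_invariant (assoc_map g S) S (Sigma_set (assoc_map g S) S)"
    unfolding Sigma_set_def Delta_diamond_def diamond_def
    using assms(1,2)
    by (intro fully_invariant_interior fully_invariant_closure fully_invariant_Delta)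
  then show ?thesis
    using assms(3) regular_open_diamond
    unfolding D_diamond_def Sigma_set_def Delta_diamond_def by blast
qed

lemma D_diamond_below_Sigma_meets:
  assumes D: "D \<in> D_diamond f S" and sub: "D \<subseteq> Sigma_set f S"
  shows "D \<inter> S \<noteq> {}"
proof -
  have "D \<subseteq> closure (Delta f S S)"
    using sub interior_subset unfolding Sigma_set_def Delta_diamond_def diamond_def by blast
  then have "D \<inter> closure (Delta f S S) \<noteq> {}"
    using D by (auto simp: D_diamond_def)
  then have "D \<inter> Delta f S S \<noteq> {}"
    using D by (simp add: D_diamond_def regular_open_def open_Int_closure_eq_empty)
  then show ?thesis
    using D fully_invariant_meets_Delta[of f S D S] by (simp add: D_diamond_def)
qed

section \<open>Counting the minimal elements\<close>

lemma minimal_in_D_diamond_disjoint: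
  assumes "minimal_in D (D_diamond (assoc_map g S) S)"
    and "minimal_in E (D_diamond (assoc_map g S) S)"
    and "D \<inter> E \<noteq> {}"
  shows "D = E"
  using assms D_diamond_Int[of D g S E] unfolding minimal_in_def
  by (metis inf.cobounded1 inf.cobounded2)

theorem theorem3:
  fixes g :: "'a::{complete_space, perfect_space} \<Rightarrow> 'a"
    and S :: "'a set"
    and f :: "'a option \<Rightarrow> 'a option"
  assumes "separable_space (euclidean :: 'a topology)"
    and "almost_regular g"
    and "closed S"
    and "interior (closure S) = {}"
    and "- regular_domain g \<subseteq> S"
    and "f = assoc_map g S"
    and "finite S"
    and "Sigma_set f S \<noteq> {}"
  shows "finite {D. minimal_in D (D_diamond f S) \<and> D \<subseteq> Sigma_set f S}
    \<and> 1 \<le> card {D. minimal_in D (D_diamond f S) \<and> D \<subseteq> Sigma_set f S}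
    \<and> card {D. minimal_in D (D_diamond f S) \<and> D \<subseteq> Sigma_set f S} \<le> card S"
proof -
  let ?M = "{D. minimal_in D (D_diamond f S) \<and> D \<subseteq> Sigma_set f S}"
  note f = \<open>f = assoc_map g S\<close>
  have reg: "regular_on (- S) g"
  proof -
    have "- S \<subseteq> regular_domain g" "open (- S)"
      using assms by (auto simp: open_Compl)
    then show ?thesis
      using regular_domain_greatest(2)[of g] unfolding regular_on_def open_map_def
      by (auto simp: openin_open_eq regular_domain_greatest(1) elim: continuous_on_subset)
  qed

  have "\<exists>D. D \<in> ?M"
  proof -
    let ?P = "\<lambda>D. D \<in> D_diamond f S \<and> D \<subseteq> Sigma_set f S"
    have "?P (Sigma_set f S)"
      using Sigma_set_in_D_diamond reg assms by blast
    then obtain D where D: "?P D" and least: "\<And>E. ?P E \<Longrightarrow> card (D \<inter> S) \<le> card (E \<inter> S)"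
      using ex_has_least_nat[of ?P _ "\<lambda>D. card (D \<inter> S)"] by blast
    have "E = D" if E: "E \<in> D_diamond f S" and "E \<subseteq> D" for E
    proof (rule ccontr)
      assume "E \<noteq> D"
      then have "\<not> D \<subseteq> E"
        using \<open>E \<subseteq> D\<close> by blast
      then have "D - closure E \<in> D_diamond f S"
        using D_diamond_Diff_closure[of S g D E] \<open>closed S\<close> reg D E f by simp
      then have "(D - closure E) \<inter> S \<noteq> {}"
        using D D_diamond_below_Sigma_meets by blast
      then have "E \<inter> S \<subset> D \<inter> S"
        using \<open>E \<subseteq> D\<close> closure_subset[of E] by blast
      then have "card (E \<inter> S) < card (D \<inter> S)"
        using \<open>finite S\<close> by (simp add: psubset_card_mono)
      moreover have "card (D \<inter> S) \<le> card (E \<inter> S)"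
        using least E \<open>E \<subseteq> D\<close> D by blast
      ultimately show False
        by simp
    qed
    then show ?thesis
      using D unfolding minimal_in_def by blast
  qed
  moreover have "finite ?M \<and> card ?M \<le> card S"
  proof -
    \<comment> \<open>Choosing a point of \<open>S\<close> in each minimal element is injective by disjointness.\<close>
    define s where "s D = (SOME x. x \<in> D \<inter> S)" for D
    have s: "s D \<in> D \<inter> S" if "D \<in> ?M" for D
    proof -
      have "D \<inter> S \<noteq> {}"
        using that D_diamond_below_Sigma_meets[of D f S] by (simp add: minimal_in_def)
      then show ?thesis
        unfolding s_def by (rule some_in_eq[THEN iffD2])
    qed
    have "inj_on s ?M"
    proof (rule inj_onI)
      fix D E assume DE: "D \<in> ?M" "E \<in> ?M" "s D = s E"
      then have "D \<inter> E \<noteq> {}"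
        using s[of D] s[of E] by auto
      then show "D = E"
        using DE f minimal_in_D_diamond_disjoint[of D g S E] by simp
    qed
    moreover have "s ` ?M \<subseteq> S"
      using s by blast
    ultimately show ?thesis
      using \<open>finite S\<close> by (meson card_inj_on_le inj_on_finite)
  qed
  ultimately have "?M \<noteq> {}" "finite ?M" "card ?M \<le> card S"
    by blast+
  then show ?thesis
    by (simp only: One_nat_def Suc_le_eq card_gt_0_iff) simp
qed

end
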